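(* For any $\ell > 0$ let $H_{\ell} = \mathbb{Z}/2\mathbb{Z}$ act on words of length $\ell$ with its generator exchanging the leftmost and rightmost letters of the word. Then, for every $\ell>0$, $\mathbf{vtm}$ avoids $(1, H_{\ell})$-squares.
   Context: The word $\mathbf{vtm} \in \{0,1,2\}^{\omega}$ is the infinite fixed point of the morphism $0 \mapsto 012$, $1 \mapsto 02$, $2 \mapsto 1$ (it begins with $0$). A factor of an infinite word is a finite contiguous subsequence. For a group $H_\ell$ acting on words of length $\ell$ by permuting positions, a $(1,H_\ell)$-square is a word $xx'$ with $|x|=|x'|=\ell$ such that $x' = h\cdot x$ for some $h\in H_\ell$ (the identity is allowed). Avoiding such squares means having no factor of this form. *)

theory Defs
  imports
    "HOL-Library.Stream"
    "HOL-Combinatorics.Permutations"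
    "HOL-Algebra.Elementary_Groups"
    "HOL-Algebra.Group_Action"
begin

section \<open>The word vtm\<close>

text \<open>The alphabet \<open>{0,1,2}\<close>; infinite words are streams.\<close>

datatype letter = L0 | L1 | L2

fun vtm_morphism :: "letter \<Rightarrow> letter list" where
  "vtm_morphism L0 = [L0, L1, L2]"
| "vtm_morphism L1 = [L0, L2]"
| "vtm_morphism L2 = [L1]"

text \<open>Extension of a morphism to infinite words by concatenating the images of the letters.
  It is meant for non-erasing morphisms only: \<^const>\<open>flat\<close> is not the concatenation if
  some image is empty.\<close>

definition apply_morphism :: "('a \<Rightarrow> 'b list) \<Rightarrow> 'a stream \<Rightarrow> 'b stream" where
  "apply_morphism f w = flat (smap f w)"

text \<open>The description is proper: see \<open>vtm_ex1\<close> below.\<close>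

definition vtm :: "letter stream" where
  "vtm = (THE w. apply_morphism vtm_morphism w = w \<and> shd w = L0)"


subsection \<open>Existence and uniqueness of the fixed point\<close>

abbreviation vtm_image :: "letter list \<Rightarrow> letter list" where
  "vtm_image u \<equiv> concat (map vtm_morphism u)"

lemma apply_morphism_shift:
  assumes "\<And>a. f a \<noteq> []"
  shows "apply_morphism f (u @- w) = concat (map f u) @- apply_morphism f w"
  using assms by (induction u) (simp_all add: apply_morphism_def)

lemma vtm_morphism_nonempty: "vtm_morphism a \<noteq> []"
  by (cases a) simp_all

lemma length_vtm_image: "length u \<le> length (vtm_image u)"
proof (induction u)
  case (Cons a u)
  then show ?case by (cases a) simp_all
qed simp

lemma length_vtm_image_L0: "hd u = L0 \<Longrightarrow> u \<noteq> [] \<Longrightarrow> length u < length (vtm_image u)"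
  using length_vtm_image[of "tl u"] by (cases u) auto

lemma stake_apply_vtm_morphism:
  assumes "n \<le> length (vtm_image (stake m w))"
  shows "stake n (apply_morphism vtm_morphism w) = take n (vtm_image (stake m w))"
proof -
  have "apply_morphism vtm_morphism w =
      vtm_image (stake m w) @- apply_morphism vtm_morphism (sdrop m w)"
    using apply_morphism_shift[OF vtm_morphism_nonempty, where u = "stake m w" and w = "sdrop m w"]
    by (simp add: stake_sdrop)
  then show ?thesis
    using assms by (simp add: stake_shift)
qed

fun vtm_prefix :: "nat \<Rightarrow> letter list" where
  "vtm_prefix 0 = [L0]"
| "vtm_prefix (Suc n) = vtm_image (vtm_prefix n)"

lemma vtm_prefix_hd: "vtm_prefix n \<noteq> [] \<and> hd (vtm_prefix n) = L0"
proof (induction n)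
  case (Suc n)
  then show ?case by (cases "vtm_prefix n") auto
qed simp

lemma length_vtm_prefix: "n < length (vtm_prefix n)"
proof (induction n)
  case (Suc n)
  then show ?case using length_vtm_image_L0[of "vtm_prefix n"] vtm_prefix_hd[of n] by simp
qed simp

lemma vtm_prefix_Suc: "\<exists>v. vtm_prefix (Suc n) = vtm_prefix n @ v"
proof (induction n)
  case (Suc n)
  then obtain v where "vtm_prefix (Suc n) = vtm_prefix n @ v" by blast
  then have "vtm_image (vtm_prefix (Suc n)) = vtm_image (vtm_prefix n) @ vtm_image v"
    by simp
  then show ?case by auto
qed simp

lemma vtm_prefix_mono: "n \<le> m \<Longrightarrow> \<exists>v. vtm_prefix m = vtm_prefix n @ v"
proof (induction m rule: dec_induct)
  case (step m)
  then show ?case using vtm_prefix_Suc[of m] by (metis append.assoc)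
qed simp

lemma stream_eqI_stake:
  assumes "\<And>n. stake n v = stake n w"
  shows "v = w"
proof -
  have "\<forall>n. stake n v = stake n w"
    using assms by blast
  then show ?thesis
  proof (coinduction arbitrary: v w)
    case Eq_stream
    have "shd v = shd w"
      using Eq_stream[THEN spec, of 1] by simp
    moreover have "stake n (stl v) = stake n (stl w)" for n
      using Eq_stream[THEN spec, of "Suc n"] by simp
    ultimately show ?case by blast
  qed
qed

lemma vtm_ex1: "\<exists>!w. apply_morphism vtm_morphism w = w \<and> shd w = L0"
proof (rule ex_ex1I)
  define v where "v = smap (\<lambda>n. vtm_prefix n ! n) nats"
  have stake_v: "stake n v = take n (vtm_prefix m)" if le: "n \<le> m" for n m
  proof (rule nth_equalityI)
    show "length (stake n v) = length (take n (vtm_prefix m))"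
      using length_vtm_prefix[of m] le by simp
    fix i assume i: "i < length (stake n v)"
    then obtain u where "vtm_prefix m = vtm_prefix i @ u"
      using vtm_prefix_mono[of i m] le by (auto simp del: vtm_prefix.simps)
    then show "stake n v ! i = take n (vtm_prefix m) ! i"
      using i length_vtm_prefix[of i] by (simp add: v_def nth_append)
  qed
  have "stake n (apply_morphism vtm_morphism v) = stake n v" for n
  proof -
    have n: "n \<le> length (vtm_image (stake n v))"
      using length_vtm_image[of "stake n v"] by simp
    have "vtm_prefix (Suc n) =
        vtm_image (stake n v) @ vtm_image (drop n (vtm_prefix n))"
      by (simp add: stake_v[of n n] flip: concat_append map_append)
    then have "take n (vtm_image (stake n v)) = take n (vtm_prefix (Suc n))"
      using n by simp
    then show ?thesis
      using stake_apply_vtm_morphism[OF n] stake_v[of n "Suc n"] by simp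
  qed
  then have "apply_morphism vtm_morphism v = v"
    by (rule stream_eqI_stake)
  moreover have "shd v = L0"
    by (simp add: v_def)
  ultimately show "\<exists>w. apply_morphism vtm_morphism w = w \<and> shd w = L0"
    by blast
next
  fix v w :: "letter stream"
  assume v: "apply_morphism vtm_morphism v = v \<and> shd v = L0"
    and w: "apply_morphism vtm_morphism w = w \<and> shd w = L0"
  have "stake (Suc n) v = stake (Suc n) w" for n
  proof (induction n)
    case 0
    show ?case using v w by simp
  next
    case (Suc n)
    have len: "Suc (Suc n) \<le> length (vtm_image (stake (Suc n) u))" if "shd u = L0" for u
      using length_vtm_image_L0[of "stake (Suc n) u"] that by simp
    have "stake (Suc (Suc n)) u = take (Suc (Suc n)) (vtm_image (stake (Suc n) u))"
      if "apply_morphism vtm_morphism u = u \<and> shd u = L0" for u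
      using stake_apply_vtm_morphism[OF len, of u] that by metis
    then show ?case
      using v w Suc.IH by metis
  qed
  then have "stake n v = stake n w" for n
    by (cases n) (simp_all del: stake.simps(2))
  then show "v = w"
    by (rule stream_eqI_stake)
qed

lemma vtm_fixed_point: "apply_morphism vtm_morphism vtm = vtm"
  and vtm_shd: "shd vtm = L0"
  using theI'[OF vtm_ex1] unfolding vtm_def by blast+


section \<open>Squares up to a group action\<close>

definition words :: "nat \<Rightarrow> 'a list set" where
  "words l = {x. length x = l}"

definition factor :: "'a list \<Rightarrow> 'a stream \<Rightarrow> bool" where
  "factor u w \<longleftrightarrow> (\<exists>p s. w = p @- u @- s)"

text \<open>A group acting on the words of length \<open>l\<close> by permuting positions. The permutation of the
  positions depends on the group element only, not on the word.\<close>

definition position_action ::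
    "('g, 'b) monoid_scheme \<Rightarrow> nat \<Rightarrow> ('g \<Rightarrow> 'a list \<Rightarrow> 'a list) \<Rightarrow> bool" where
  "position_action H l \<phi> \<longleftrightarrow> group_action H (words l) \<phi> \<and>
     (\<forall>h\<in>carrier H. \<exists>p. p permutes {..<l} \<and> (\<forall>x\<in>words l. \<phi> h x = permute_list p x))"

text \<open>The \<open>(1, H)\<close>-squares \<open>x x'\<close> with \<open>|x| = |x'| = l\<close>, where \<open>H\<close> acts on the words of length
  \<open>l\<close> via \<open>\<phi>\<close>.\<close>

definition one_square ::
    "('g, 'b) monoid_scheme \<Rightarrow> nat \<Rightarrow> ('g \<Rightarrow> 'a list \<Rightarrow> 'a list) \<Rightarrow> 'a list \<Rightarrow> bool" where
  "one_square H l \<phi> u \<longleftrightarrow>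
     (\<exists>x\<in>words l. \<exists>x'\<in>words l. u = x @ x' \<and> (\<exists>h\<in>carrier H. x' = \<phi> h x))"

definition avoids_one_squares ::
    "('g, 'b) monoid_scheme \<Rightarrow> nat \<Rightarrow> ('g \<Rightarrow> 'a list \<Rightarrow> 'a list) \<Rightarrow> 'a stream \<Rightarrow> bool" where
  "avoids_one_squares H l \<phi> w \<longleftrightarrow> \<not> (\<exists>u. factor u w \<and> one_square H l \<phi> u)"


subsection \<open>The action of the cyclic group of order two exchanging the end letters\<close>

text \<open>The carrier of \<^term>\<open>integer_mod_group 2\<close> is \<open>{0, 1}\<close> with generator \<open>1\<close>. For \<open>l = 1\<close> the two
  ends coincide, and the generator acts trivially. The restriction to \<^term>\<open>words l\<close> is required
  by the extensional functions of \<^const>\<open>BijGroup\<close>.\<close>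

definition swap_ends_action :: "nat \<Rightarrow> int \<Rightarrow> 'a list \<Rightarrow> 'a list" where
  "swap_ends_action l h =
     (\<lambda>x\<in>words l. if h = 0 then x else permute_list (transpose 0 (l - 1)) x)"

lemma transpose_ends_permutes: "(l::nat) > 0 \<Longrightarrow> transpose 0 (l - 1) permutes {..<l}"
  by (rule permutes_swap_id) simp_all

lemma swap_ends_involution:
  assumes "l > 0" "x \<in> words l"
  shows "permute_list (transpose 0 (l - 1)) (permute_list (transpose 0 (l - 1)) x) = x"
  using assms permute_list_compose[of "transpose 0 (l - 1)" x "transpose 0 (l - 1)"]
    transpose_ends_permutes[of l]
  by (simp add: words_def)

lemma swap_ends_position_action:
  assumes "l > 0"
  shows "position_action (integer_mod_group 2) l
    (swap_ends_action l :: int \<Rightarrow> 'a list \<Rightarrow> 'a list)"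
proof -
  let ?\<phi> = "swap_ends_action l :: int \<Rightarrow> 'a list \<Rightarrow> 'a list"
  have carrier: "carrier (integer_mod_group 2) = {0, 1}"
    by (auto simp: carrier_integer_mod_group)
  have closed: "?\<phi> h x \<in> words l" if "x \<in> words l" for h x
    using that by (simp add: swap_ends_action_def words_def)
  have invol: "?\<phi> h (?\<phi> h x) = x" if "x \<in> words l" for h x
    using that closed[OF that, of h] swap_ends_involution[OF assms that]
    by (auto simp: swap_ends_action_def)
  have bij: "?\<phi> h \<in> Bij (words l)" for h
  proof -
    have "bij_betw (?\<phi> h) (words l) (words l)"
      by (rule bij_betw_byWitness[where f' = "?\<phi> h"]) (auto simp: invol closed)
    then show ?thesis
      by (simp add: Bij_def swap_ends_action_def)
  qed
  have mult: "?\<phi> ((g + h) mod 2) = compose (words l) (?\<phi> g) (?\<phi> h)"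
    if "g \<in> {0, 1}" "h \<in> {0, 1}" for g h
  proof
    fix x
    show "?\<phi> ((g + h) mod 2) x = compose (words l) (?\<phi> g) (?\<phi> h) x"
    proof (cases "x \<in> words l")
      case True
      have "?\<phi> 0 y = y" if "y \<in> words l" for y
        using that by (simp add: swap_ends_action_def)
      with True that show ?thesis
        using invol[OF True, of 1] closed[OF True]
        by (auto simp: compose_def)
    next
      case False
      then show ?thesis by (simp add: compose_def swap_ends_action_def)
    qed
  qed
  have "?\<phi> \<in> hom (integer_mod_group 2) (BijGroup (words l))"
    by (rule homI) (auto simp: carrier BijGroup_def bij mult)
  then have "group_action (integer_mod_group 2) (words l) ?\<phi>"
    by (simp add: group_action_def group_hom_def group_hom_axioms_def group_BijGroup)
  moreover have "\<exists>p. p permutes {..<l} \<and> (\<forall>x\<in>words l. ?\<phi> h x = permute_list p x)" for h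
  proof (cases "h = 0")
    case True
    then show ?thesis
      by (intro exI[of _ id]) (simp add: swap_ends_action_def permutes_id)
  next
    case False
    then show ?thesis
      using transpose_ends_permutes[OF assms]
      by (intro exI[of _ "transpose 0 (l - 1)"]) (simp add: swap_ends_action_def)
  qed
  ultimately show ?thesis
    by (simp add: position_action_def)
qed

text \<open>On words with at least two letters, the generator does exchange the end letters.\<close>

lemma swap_ends_action_1: "swap_ends_action (length u + 2) 1 (a # u @ [b]) = b # u @ [a]"
proof (rule nth_equalityI)
  show "length (swap_ends_action (length u + 2) 1 (a # u @ [b])) = length (b # u @ [a])"
    by (simp add: swap_ends_action_def words_def)
  fix i assume "i < length (swap_ends_action (length u + 2) 1 (a # u @ [b]))"
  then have "i < length u + 2"
    by (simp add: swap_ends_action_def words_def)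
  then show "swap_ends_action (length u + 2) 1 (a # u @ [b]) ! i = (b # u @ [a]) ! i"
    by (auto simp: swap_ends_action_def words_def permute_list_def transpose_def
        nth_append nth_Cons' simp del: upt_Suc)
qed

end

theory Submission
  imports Defs
begin

text \<open>
  Exchanging the ends of \<open>x = a u b\<close> gives \<open>x x' = a u b b u a\<close>, whose middle \<open>b b\<close> is already a
  square; so the theorem reduces to the absence of ordinary squares in \<^const>\<open>vtm\<close>.

  The latter comes from the Thue-Morse sequence \<open>t\<close>, given by \<open>t (2n) = t n\<close> and
  \<open>t (2n+1) = 1 - t n\<close>. The word \<^const>\<open>vtm\<close> codes its differences: the \<open>n\<close>-th letter is
  \<open>0, 1, 2\<close> according to \<open>t (n+1) - t n = 1, 0, -1\<close> (\<open>vtm_eq_difference_stream\<close>). A square of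
  period \<open>l\<close> at \<open>i\<close> makes \<open>t (j+l) - t j\<close> constant for \<open>i \<le> j \<le> i+l\<close>. Hence
  \<open>t i, t (i+l), t (i+2l)\<close> is an arithmetic progression in \<open>{0,1}\<close>, the constant is \<open>0\<close>, and \<open>t\<close>
  has an overlap: a factor of length \<open>2l+1\<close> and period \<open>l\<close>. But \<open>t\<close> has none
  (\<open>thue_morse_overlap_free\<close>): an overlap of even period would descend to one of half the
  period, and an overlap of odd period is incompatible with the parity of the positions at
  which \<open>t\<close> repeats a letter.
\<close>

fun thue_morse :: "nat \<Rightarrow> nat" where
  "thue_morse n = (if n = 0 then 0
     else if even n then thue_morse (n div 2) else 1 - thue_morse (n div 2))"

declare thue_morse.simps [simp del]

lemma thue_morse_le_1: "thue_morse n \<le> 1"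
proof (induction n rule: less_induct)
  case (less n)
  then show ?case by (subst thue_morse.simps) auto
qed

lemma thue_morse_double: "thue_morse (2 * n) = thue_morse n"
  by (cases "n = 0") (simp_all add: thue_morse.simps[of "2 * n"])

lemma thue_morse_Suc_double: "thue_morse (Suc (2 * n)) = 1 - thue_morse n"
  by (simp add: thue_morse.simps[of "Suc (2 * n)"])

lemma thue_morse_Suc_even:
  assumes "even n"
  shows "thue_morse (Suc n) \<noteq> thue_morse n"
proof -
  obtain m where "n = 2 * m" using assms by blast
  then show ?thesis
    using thue_morse_le_1[of m] by (simp add: thue_morse_double thue_morse_Suc_double) arith
qed

lemma thue_morse_overlap_free:
  assumes "l > 0"
  shows "\<exists>k\<le>l. thue_morse (i + k) \<noteq> thue_morse (i + l + k)"
  using assms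
proof (induction l arbitrary: i rule: less_induct)
  case (less l)
  show ?case
  proof (rule ccontr)
    assume "\<not> ?thesis"
    then have overlap: "thue_morse (i + k) = thue_morse (i + l + k)" if "k \<le> l" for k
      using that by blast
    show False
    proof (cases "even l")
      case True
      then obtain m where m: "l = 2 * m" by blast
      \<comment> \<open>Every second letter of the overlap lies on a position of the parity of \<open>i\<close>; these letters
        are those of a factor of \<open>t\<close> at \<open>i div 2\<close>, all complemented if \<open>i\<close> is odd.\<close>
      define j where "j = i div 2"
      have "thue_morse (j + k) = thue_morse (j + m + k)" if "k \<le> m" for k
      proof (cases "even i")
        case True
        then have "i + 2 * k = 2 * (j + k)" "i + l + 2 * k = 2 * (j + m + k)"
          by (simp_all add: j_def m)
        then have "thue_morse (i + 2 * k) = thue_morse (j + k)"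
          "thue_morse (i + l + 2 * k) = thue_morse (j + m + k)"
          by (simp_all only: thue_morse_double)
        then show ?thesis
          using overlap[of "2 * k"] that m by simp
      next
        case False
        then have "i = Suc (2 * j)" by (simp add: j_def)
        then have "i + 2 * k = Suc (2 * (j + k))" "i + l + 2 * k = Suc (2 * (j + m + k))"
          by (simp_all add: m)
        then have "thue_morse (i + 2 * k) = 1 - thue_morse (j + k)"
          "thue_morse (i + l + 2 * k) = 1 - thue_morse (j + m + k)"
          by (simp_all only: thue_morse_Suc_double)
        then show ?thesis
          using overlap[of "2 * k"] that m thue_morse_le_1[of "j + k"] thue_morse_le_1[of "j + m + k"]
          by simp
      qed
      moreover have "m < l" "0 < m" using less.prems m by auto
      ultimately show False using less.IH[of m j] by blast
    next
      case odd: False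
      \<comment> \<open>One of the positions \<open>i + k\<close> and \<open>i + l + k\<close> is even, so the letter following it differs
        from it. Hence the letters alternate throughout.\<close>
      have step: "thue_morse (i + Suc k) = 1 - thue_morse (i + k)" if "k < l" for k
      proof -
        have "thue_morse (Suc (i + k)) \<noteq> thue_morse (i + k)"
        proof (cases "even (i + k)")
          case False
          then have "even (i + l + k)" using odd by auto
          then show ?thesis
            using thue_morse_Suc_even[of "i + l + k"] overlap[of k] overlap[of "Suc k"] that by simp
        qed (rule thue_morse_Suc_even)
        then show ?thesis
          using thue_morse_le_1[of "i + k"] thue_morse_le_1[of "Suc (i + k)"] by auto
      qed
      have "thue_morse (i + k) = (if even k then thue_morse i else 1 - thue_morse i)"
        if "k \<le> l" for k
        using that
      proof (induction k)
        case (Suc k)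
        then show ?case using step[of k] thue_morse_le_1[of i] by auto
      qed simp
      from this[of l] have "thue_morse (i + l) = 1 - thue_morse i" using odd by simp
      moreover have "thue_morse (i + l) = thue_morse i" using overlap[of 0] by simp
      ultimately show False using thue_morse_le_1[of i] by arith
    qed
  qed
qed

definition difference_letter :: "nat \<Rightarrow> letter" where
  "difference_letter n =
     (if thue_morse n = thue_morse (Suc n) then L1
      else if thue_morse n = 0 then L0 else L2)"

definition difference_stream :: "nat \<Rightarrow> letter stream" where
  "difference_stream n = smap difference_letter (fromN n)"

lemma difference_stream_unfold:
  "difference_stream n = difference_letter n ## difference_stream (Suc n)"
  unfolding difference_stream_def by (subst siterate.code) simp

lemma difference_letter_eq_iff:
  "difference_letter m = difference_letter n \<longleftrightarrow>
     thue_morse (Suc m) + thue_morse n = thue_morse (Suc n) + thue_morse m"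
  using thue_morse_le_1[of m] thue_morse_le_1[of n]
    thue_morse_le_1[of "Suc m"] thue_morse_le_1[of "Suc n"]
  unfolding difference_letter_def by simp

text \<open>The images of the letters \<open>0, 1, 2\<close> have lengths \<open>3, 2, 1\<close>, which is \<open>2\<close> plus the coded
  difference. Telescoping, the image of the \<open>n\<close>-th letter begins at position \<open>2 n + t n\<close>.\<close>

lemma difference_stream_desubstitute:
  "difference_stream (2 * n + thue_morse n) =
     vtm_morphism (difference_letter n) @- difference_stream (2 * Suc n + thue_morse (Suc n))"
proof -
  have t: "thue_morse (2 * n) = thue_morse n" "thue_morse (Suc (2 * n)) = 1 - thue_morse n"
    "thue_morse (Suc (Suc (2 * n))) = thue_morse (Suc n)"
    "thue_morse (Suc (Suc (Suc (2 * n)))) = 1 - thue_morse (Suc n)"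
    using thue_morse_double[of n] thue_morse_Suc_double[of n]
      thue_morse_double[of "Suc n"] thue_morse_Suc_double[of "Suc n"] by simp_all
  have "thue_morse n = 0 \<or> thue_morse n = 1" "thue_morse (Suc n) = 0 \<or> thue_morse (Suc n) = 1"
    using thue_morse_le_1[of n] thue_morse_le_1[of "Suc n"] by auto
  then show ?thesis
    by (elim disjE)
      (simp_all add: difference_letter_def t
        difference_stream_unfold[of "2 * n"] difference_stream_unfold[of "Suc (2 * n)"]
        difference_stream_unfold[of "Suc (Suc (2 * n))"])
qed

lemma apply_vtm_morphism_difference_stream:
  "apply_morphism vtm_morphism (difference_stream n) = difference_stream (2 * n + thue_morse n)"
proof (rule stream_eqI_stake)
  fix k
  show "stake k (apply_morphism vtm_morphism (difference_stream n)) =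
    stake k (difference_stream (2 * n + thue_morse n))"
  proof (induction k arbitrary: n rule: less_induct)
    case (less k)
    let ?u = "vtm_morphism (difference_letter n)"
    have "apply_morphism vtm_morphism (difference_stream n) =
        ?u @- apply_morphism vtm_morphism (difference_stream (Suc n))"
      using apply_morphism_shift[of vtm_morphism "[difference_letter n]", OF vtm_morphism_nonempty]
      by (simp add: difference_stream_unfold[of n])
    moreover have "stake (k - length ?u)
          (apply_morphism vtm_morphism (difference_stream (Suc n))) =
        stake (k - length ?u) (difference_stream (2 * Suc n + thue_morse (Suc n)))"
    proof (cases "k = 0")
      case False
      have "length ?u > 0" using vtm_morphism_nonempty by simp
      with False have "k - length ?u < k" by simp
      then show ?thesis by (rule less.IH)
    qed simp
    ultimately show ?case
      by (simp only: difference_stream_desubstitute[of n] stake_shift)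
  qed
qed

lemma vtm_eq_difference_stream: "vtm = difference_stream 0"
proof -
  have "thue_morse 0 = 0" "thue_morse (Suc 0) = 1"
    by (simp_all add: thue_morse.simps)
  then have "apply_morphism vtm_morphism (difference_stream 0) = difference_stream 0"
    "shd (difference_stream 0) = L0"
    using apply_vtm_morphism_difference_stream[of 0]
    by (simp_all add: difference_stream_def difference_letter_def)
  then show ?thesis
    using vtm_ex1 vtm_fixed_point vtm_shd by blast
qed

lemma vtm_nth: "vtm !! n = difference_letter n"
  by (simp add: vtm_eq_difference_stream difference_stream_def)

lemma vtm_square_free:
  assumes "l > 0"
  shows "\<exists>k<l. vtm !! (i + k) \<noteq> vtm !! (i + l + k)"
proof (rule ccontr)
  assume "\<not> ?thesis"
  then have square: "difference_letter (i + k) = difference_letter (i + l + k)" if "k < l" for k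
    using that unfolding vtm_nth by blast
  have shift: "thue_morse (i + l + k) + thue_morse i = thue_morse (i + k) + thue_morse (i + l)"
    if "k \<le> l" for k
    using that
  proof (induction k)
    case (Suc k)
    then have "thue_morse (Suc (i + k)) + thue_morse (i + l + k) =
        thue_morse (Suc (i + l + k)) + thue_morse (i + k)"
      using square[of k] by (simp only: difference_letter_eq_iff Suc_le_eq)
    moreover have "thue_morse (i + l + k) + thue_morse i = thue_morse (i + k) + thue_morse (i + l)"
      using Suc by simp
    ultimately show ?case
      unfolding add_Suc_right by linarith
  qed simp
  have "thue_morse (i + l) = thue_morse i"
    using shift[of l] thue_morse_le_1[of i] thue_morse_le_1[of "i + l"]
      thue_morse_le_1[of "i + l + l"] by linarith
  then have "thue_morse (i + k) = thue_morse (i + l + k)" if "k \<le> l" for k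
    using shift[OF that] by linarith
  then show False
    using thue_morse_overlap_free[OF assms, of i] by blast
qed

theorem theorem4p4:
  fixes l :: nat
  assumes "l > 0"
  shows "avoids_one_squares (integer_mod_group 2) l (swap_ends_action l) vtm"
  unfolding avoids_one_squares_def
proof
  assume "\<exists>u. factor u vtm \<and> one_square (integer_mod_group 2) l (swap_ends_action l) u"
  then obtain p x x' s and h :: int where x: "length x = l" and x': "length x' = l"
    and factor: "vtm = p @- (x @ x') @- s" and h: "x' = swap_ends_action l h x"
    unfolding factor_def one_square_def words_def by blast
  have nth_x: "vtm !! (length p + k) = x ! k" if "k < l" for k
    using that x by (simp add: factor)
  have nth_x': "vtm !! (length p + l + k) = x' ! k" if "k < l" for k
    using that x x' by (simp add: factor)
  show False
  proof (cases "h = 0")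
    case True
    then have "x' = x" using h x by (simp add: swap_ends_action_def words_def)
    then have "vtm !! (length p + k) = vtm !! (length p + l + k)" if "k < l" for k
      using nth_x[OF that] nth_x'[OF that] by simp
    then show False
      using vtm_square_free[OF assms, of "length p"] by blast
  next
    case False
    \<comment> \<open>The letters on both sides of the border between \<open>x\<close> and \<open>x'\<close> agree. For \<open>l = 1\<close> this is
      because the exchange of the end letters is trivial.\<close>
    then have "x' ! 0 = x ! (l - 1)"
      using h x assms by (simp add: swap_ends_action_def words_def permute_list_def)
    then have "vtm !! (length p + (l - 1)) = vtm !! (length p + (l - 1) + 1)"
      using nth_x[of "l - 1"] nth_x'[of 0] assms by simp
    then show False
      using vtm_square_free[of 1 "length p + (l - 1)"] by simp
  qed
qed

end
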